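(* Let $\alpha: I\subset\mathbb{R}\to\mathbb{E}^3$ be a curve parametrized by arc length $s$ with unit tangent $T=\alpha'$, let $\{T,N_1,N_2\}$ be a differentiable, positively oriented orthonormal frame along $\alpha$, and let $k_1,k_2: I\to\mathbb{R}$ be functions. Let $\phi: I\to\mathbb{C}^2$ be a differentiable two-component spinor with $\overline{\phi}^{\,t}\phi=1$ which represents the triad $\{N_1,N_2,T\}$, i.e. $$N_1+iN_2=\phi^t\sigma\phi,\qquad T=-\hat\phi^{\,t}\sigma\phi .$$ Then the type-1 Bishop equations with Bishop curvatures $k_1,k_2$, $$\frac{dT}{ds}=k_1N_1+k_2N_2,\qquad \frac{dN_1}{ds}=-k_1T,\qquad \frac{dN_2}{ds}=-k_2T,$$ are equivalent to the single spinor equation $$\frac{d\phi}{ds}=\frac12\,(k_1+i\,k_2)\,\hat\phi .$$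
   Context: $\mathbb{E}^3$ is $\mathbb{R}^3$ with the standard flat metric. A spinor is a vector $\phi=\begin{pmatrix}\phi_1\\ \phi_2\end{pmatrix}\in\mathbb{C}^2$; $\overline{\phi}$ is its componentwise complex conjugate, the superscript $t$ denotes transposition, and the mate of $\phi$ is $\hat\phi=\begin{pmatrix}-\overline{\phi_2}\\ \overline{\phi_1}\end{pmatrix}$. The symbol $\sigma=(\sigma_1,\sigma_2,\sigma_3)$ denotes the triple of complex symmetric matrices $$\sigma_1=\begin{pmatrix}1&0\\0&-1\end{pmatrix},\quad \sigma_2=\begin{pmatrix}i&0\\0&i\end{pmatrix},\quad \sigma_3=\begin{pmatrix}0&-1\\-1&0\end{pmatrix},$$ and for spinors $\phi,\psi$ one writes $\phi^t\sigma\psi=(\phi^t\sigma_1\psi,\phi^t\sigma_2\psi,\phi^t\sigma_3\psi)\in\mathbb{C}^3$. A frame $\{T,N_1,N_2\}$ along a unit speed curve satisfying the three displayed Bishop equations is called a type-1 Bishop frame, and the real functions $k_1,k_2$ are called its first and second Bishop curvatures. *)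

theory Defs
  imports "HOL-Analysis.Analysis"
begin

type_synonym spinor = "complex ^ 2"

definition mate :: "spinor \<Rightarrow> spinor" where
  "mate \<phi> = vector [- cnj (\<phi> $ 2), cnj (\<phi> $ 1)]"

text \<open>The matrices are listed by rows.\<close>

definition sigma1 :: "complex ^ 2 ^ 2" where
  "sigma1 = vector [vector [1, 0], vector [0, -1]]"

definition sigma2 :: "complex ^ 2 ^ 2" where
  "sigma2 = vector [vector [\<i>, 0], vector [0, \<i>]]"

definition sigma3 :: "complex ^ 2 ^ 2" where
  "sigma3 = vector [vector [0, -1], vector [-1, 0]]"

text \<open>The pairing $\phi^t M \psi$ is bilinear: there is no complex conjugation, so it is not
  the library's (real) inner product on \<^typ>\<open>complex ^ 2\<close>.\<close>

definition transpose_pairing :: "spinor \<Rightarrow> complex ^ 2 ^ 2 \<Rightarrow> spinor \<Rightarrow> complex" where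
  "transpose_pairing \<phi> M \<psi> = (\<Sum>a\<in>UNIV. \<phi> $ a * (M *v \<psi>) $ a)"

definition sigma_pairing :: "spinor \<Rightarrow> spinor \<Rightarrow> complex ^ 3" where
  "sigma_pairing \<phi> \<psi> =
     vector [transpose_pairing \<phi> sigma1 \<psi>, transpose_pairing \<phi> sigma2 \<psi>,
             transpose_pairing \<phi> sigma3 \<psi>]"

definition normalized_spinor :: "spinor \<Rightarrow> bool" where
  "normalized_spinor \<phi> \<longleftrightarrow> (\<Sum>a\<in>UNIV. cnj (\<phi> $ a) * \<phi> $ a) = 1"

text \<open>The inclusion of $\mathbb{R}^3$ into $\mathbb{C}^3$.\<close>

definition complexify :: "real ^ 3 \<Rightarrow> complex ^ 3" where
  "complexify v = (\<chi> j. complex_of_real (v $ j))"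

definition represents_triad ::
  "spinor \<Rightarrow> real ^ 3 \<Rightarrow> real ^ 3 \<Rightarrow> real ^ 3 \<Rightarrow> bool" where
  "represents_triad \<phi> A B C \<longleftrightarrow>
     complexify A + \<i> *s complexify B = sigma_pairing \<phi> \<phi> \<and>
     complexify C = - sigma_pairing (mate \<phi>) \<phi>"

definition positive_orthonormal :: "real ^ 3 \<Rightarrow> real ^ 3 \<Rightarrow> real ^ 3 \<Rightarrow> bool" where
  "positive_orthonormal A B C \<longleftrightarrow>
     norm A = 1 \<and> norm B = 1 \<and> norm C = 1 \<and>
     orthogonal A B \<and> orthogonal A C \<and> orthogonal B C \<and>
     det (vector [A, B, C] :: real ^ 3 ^ 3) > 0"

text \<open>Derivatives are taken within the interval, hence one-sided at an endpoint belonging to it.\<close>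

definition unit_speed_curve_with_tangent ::
  "real set \<Rightarrow> (real \<Rightarrow> real ^ 3) \<Rightarrow> (real \<Rightarrow> real ^ 3) \<Rightarrow> bool" where
  "unit_speed_curve_with_tangent I \<alpha> T \<longleftrightarrow>
     (\<forall>s\<in>I. (\<alpha> has_vector_derivative T s) (at s within I) \<and> norm (T s) = 1)"

definition type1_Bishop_equations ::
  "real set \<Rightarrow> (real \<Rightarrow> real ^ 3) \<Rightarrow> (real \<Rightarrow> real ^ 3) \<Rightarrow> (real \<Rightarrow> real ^ 3) \<Rightarrow>
   (real \<Rightarrow> real) \<Rightarrow> (real \<Rightarrow> real) \<Rightarrow> bool" where
  "type1_Bishop_equations I T N1 N2 k1 k2 \<longleftrightarrow>
     (\<forall>s\<in>I.
        (T has_vector_derivative k1 s *\<^sub>R N1 s + k2 s *\<^sub>R N2 s) (at s within I) \<and>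
        (N1 has_vector_derivative - k1 s *\<^sub>R T s) (at s within I) \<and>
        (N2 has_vector_derivative - k2 s *\<^sub>R T s) (at s within I))"

definition spinor_equation ::
  "real set \<Rightarrow> (real \<Rightarrow> spinor) \<Rightarrow> (real \<Rightarrow> real) \<Rightarrow> (real \<Rightarrow> real) \<Rightarrow> bool" where
  "spinor_equation I \<phi> k1 k2 \<longleftrightarrow>
     (\<forall>s\<in>I. (\<phi> has_vector_derivative
        ((1 / 2) * (complex_of_real (k1 s) + \<i> * complex_of_real (k2 s))) *s mate (\<phi> s))
        (at s within I))"

end

theory Submission
  imports Defs
begin

text \<open>Write $\phi = (a, b)$ and $K = k_1 + i k_2$. In coordinates $N_1 + i N_2$ is
  $(a^2 - b^2, i(a^2 + b^2), -2ab)$, so the Bishop equations for $N_1, N_2$, taken together as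
  $(N_1 + i N_2)' = -K T$, are linear equations for $(a', b')$. Since $(a, b) \neq 0$, their only
  solution is $a' = -K \bar b / 2$, $b' = K \bar a / 2$, that is $\phi' = K \hat\phi / 2$.
  The equation for $T'$ then follows by differentiating $T = -\hat\phi^t \sigma \phi$.\<close>

text \<open>Coordinate projections are bounded linear, and conversely limits in a finite product can
  be checked coordinate by coordinate. This reduces the vector equations to scalar ones.\<close>

lemma has_vector_derivative_vec_iff:
  fixes f :: "real \<Rightarrow> 'a::real_normed_vector ^ 'n"
  shows "(f has_vector_derivative D) (at s within I) \<longleftrightarrow>
    (\<forall>i. ((\<lambda>t. f t $ i) has_vector_derivative D $ i) (at s within I))"
proof
  assume "(f has_vector_derivative D) (at s within I)"
  then show "\<forall>i. ((\<lambda>t. f t $ i) has_vector_derivative D $ i) (at s within I)"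
    by (auto intro: bounded_linear.has_vector_derivative[OF bounded_linear_vec_nth])
next
  assume *: "\<forall>i. ((\<lambda>t. f t $ i) has_vector_derivative D $ i) (at s within I)"
  have "((\<lambda>y. (1 / norm (y - s)) *\<^sub>R (f y - (f s + (y - s) *\<^sub>R D))) \<longlongrightarrow> 0) (at s within I)"
  proof (rule vec_tendstoI)
    fix i
    show "((\<lambda>y. ((1 / norm (y - s)) *\<^sub>R (f y - (f s + (y - s) *\<^sub>R D))) $ i) \<longlongrightarrow> 0 $ i) (at s within I)"
      using *[rule_format, of i]
      by (simp add: has_vector_derivative_def has_derivative_within)
  qed
  then show "(f has_vector_derivative D) (at s within I)"
    by (simp add: has_vector_derivative_def has_derivative_within bounded_linear_scaleR_left)
qed

text \<open>A connected set other than a singleton has no isolated points. This makes derivatives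
  within \<open>I\<close> unique, including the one-sided ones at endpoints.\<close>

lemma interval_at_within_nontrivial:
  fixes I :: "real set"
  assumes "is_interval I" "interior I \<noteq> {}" "s \<in> I"
  shows "at s within I \<noteq> bot"
proof -
  have "\<And>x. I \<noteq> {x}"
    using assms(2) by auto
  then have "s islimpt I"
    using assms by (intro connected_imp_perfect is_interval_connected) auto
  then show ?thesis
    by (simp add: trivial_limit_within)
qed

text \<open>Direct expansion of the sigma matrices. The first three expressions contain no
  conjugates, so their derivatives are complex linear in the derivatives of \<open>a\<close> and
  \<open>b\<close>.\<close>

lemma represents_triad_components:
  fixes \<phi> :: spinor
  defines "a \<equiv> \<phi> $ 1" and "b \<equiv> \<phi> $ 2"
  assumes "represents_triad \<phi> A B C"
  shows "Complex (A $ 1) (B $ 1) = a\<^sup>2 - b\<^sup>2"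
    and "Complex (A $ 2) (B $ 2) = \<i> * (a\<^sup>2 + b\<^sup>2)"
    and "Complex (A $ 3) (B $ 3) = - 2 * a * b"
    and "complex_of_real (C $ 1) = cnj b * a + cnj a * b"
    and "complex_of_real (C $ 2) = \<i> * (cnj b * a - cnj a * b)"
    and "complex_of_real (C $ 3) = cnj a * a - cnj b * b"
  using assms(3)
  unfolding represents_triad_def vec_eq_iff forall_3 a_def b_def
  by (auto simp: Complex_eq complexify_def sigma_pairing_def transpose_pairing_def sigma1_def
      sigma2_def sigma3_def mate_def sum_2 matrix_vector_mult_def power2_eq_square algebra_simps)

text \<open>Here \<open>c\<close> and \<open>d\<close> stand for the derivatives of \<open>a\<close>
  and \<open>b\<close>, and the left side is \<open>(N1 + i N2)' = -K T\<close> in coordinates: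
  three linear equations for two unknowns. They are consistent, and a nonzero spinor makes the
  solution unique.\<close>

lemma spinor_velocity_iff:
  fixes a b c d K :: complex
  assumes nonzero: "a \<noteq> 0 \<or> b \<noteq> 0"
  shows "2 * (a * c - b * d) = - K * (cnj b * a + cnj a * b) \<and>
      2 * \<i> * (a * c + b * d) = - K * (\<i> * (cnj b * a - cnj a * b)) \<and>
      - 2 * (a * d + c * b) = - K * (cnj a * a - cnj b * b) \<longleftrightarrow>
    c = - K / 2 * cnj b \<and> d = K / 2 * cnj a"
proof (rule iffI, goal_cases)
  case 1
  then have 1: "2 * (a * c - b * d) = - K * (cnj b * a + cnj a * b)"
    and 2: "2 * \<i> * (a * c + b * d) = - K * (\<i> * (cnj b * a - cnj a * b))"
    and 3: "- 2 * (a * d + c * b) = - K * (cnj a * a - cnj b * b)"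
    by blast+
  have "\<i> * (2 * (a * c + b * d)) = \<i> * (- K * (cnj b * a - cnj a * b))"
    using 2 by (simp only: ac_simps)
  then have 2: "2 * (a * c + b * d) = - K * (cnj b * a - cnj a * b)"
    by (simp only: mult_cancel_left) simp
  \<comment> \<open>The sum of the first two equations isolates \<open>c\<close>; their difference,
    used next, isolates \<open>d\<close>.\<close>
  have "4 * (a * (c + K / 2 * cnj b)) = 0"
    using 1 2 by algebra
  then have c: "a = 0 \<or> c + K / 2 * cnj b = 0" by simp
  have "4 * (b * (d - K / 2 * cnj a)) = 0"
    using 1 2 by algebra
  then have d: "b = 0 \<or> d - K / 2 * cnj a = 0" by simp
  \<comment> \<open>Needed when one coordinate vanishes: if \<open>a = 0\<close>, then
    \<open>b\<close> is nonzero and this equation determines \<open>c\<close>; the case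
    \<open>b = 0\<close> is symmetric.\<close>
  have "2 * (a * (d - K / 2 * cnj a) + b * (c + K / 2 * cnj b)) = 0"
    using 3 by algebra
  then have e: "a * (d - K / 2 * cnj a) + b * (c + K / 2 * cnj b) = 0"
    by (simp only: mult_eq_0_iff) simp
  have "c + K / 2 * cnj b = 0 \<and> d - K / 2 * cnj a = 0"
    using nonzero c d e by auto
  then show ?case
    by (auto simp: add_eq_0_iff2)
next
  case 2
  then have c: "c = - K / 2 * cnj b" and d: "d = K / 2 * cnj a"
    by blast+
  show ?case
    unfolding c d by (simp add: field_simps)
qed

text \<open>At a fixed point only the values \<open>p\<close> and \<open>q\<close> of the curvatures
  matter. Since \<open>\<phi>\<close> is differentiable there, both sides turn into algebraic
  conditions on its derivative.\<close>

lemma Bishop_iff_spinor_at: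
  fixes T N1 N2 :: "real \<Rightarrow> real ^ 3" and \<phi> :: "real \<Rightarrow> spinor" and p q s :: real
  assumes nontriv: "at s within I \<noteq> bot" and s: "s \<in> I"
    and diff: "\<phi> differentiable (at s within I)"
    and unit: "normalized_spinor (\<phi> s)"
    and rep: "\<And>t. t \<in> I \<Longrightarrow> represents_triad (\<phi> t) (N1 t) (N2 t) (T t)"
  shows "(T has_vector_derivative p *\<^sub>R N1 s + q *\<^sub>R N2 s) (at s within I) \<and>
        (N1 has_vector_derivative - p *\<^sub>R T s) (at s within I) \<and>
        (N2 has_vector_derivative - q *\<^sub>R T s) (at s within I) \<longleftrightarrow>
     (\<phi> has_vector_derivative
        ((1 / 2) * (complex_of_real p + \<i> * complex_of_real q)) *s mate (\<phi> s))
        (at s within I)" (is "_ \<longleftrightarrow> ?spin")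
proof -
  define F where "F = at s within I"
  define a where "a t = \<phi> t $ 1" for t
  define b where "b t = \<phi> t $ 2" for t
  define K where "K = Complex p q"
  obtain D where D: "(\<phi> has_vector_derivative D) F"
    using diff vector_derivative_works unfolding F_def by blast
  define c where "c = D $ 1"
  define d where "d = D $ 2"
  have ab: "(a has_vector_derivative c) F" "(b has_vector_derivative d) F"
    using D unfolding F_def has_vector_derivative_vec_iff a_def b_def c_def d_def by auto
  note rules = has_vector_derivative_mult has_vector_derivative_add has_vector_derivative_diff
     has_vector_derivative_cnj has_vector_derivative_const ab[unfolded F_def]
  have uniq: "x = y" if "(f has_vector_derivative x) F" "(f has_vector_derivative y) F"
    for f and x y :: complex
    using vector_derivative_unique_within nontriv that unfolding F_def by blast
  \<comment> \<open>Agreement on \<open>I\<close> transfers the derivative of \<open>g\<close> to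
    \<open>f\<close>, and uniqueness turns a claim about derivatives into an equation of
    numbers.\<close>
  have deriv_iff: "(f has_vector_derivative x) F \<longleftrightarrow> x = E"
    if "\<And>t. t \<in> I \<Longrightarrow> f t = g t" "(g has_vector_derivative E) F" for f g and x E :: complex
    using has_vector_derivative_transform[OF s, of f g E] uniq[of f x E] that unfolding F_def by blast
  have spin_iff: "?spin \<longleftrightarrow> c = - K / 2 * cnj (b s) \<and> d = K / 2 * cnj (a s)"
  proof -
    have K: "complex_of_real p + \<i> * complex_of_real q = K"
      by (simp add: K_def Complex_eq)
    have "?spin \<longleftrightarrow> D = (1 / 2 * K) *s mate (\<phi> s)"
      using D vector_derivative_unique_within[OF nontriv] unfolding F_def K by blast
    also have "\<dots> \<longleftrightarrow>
        c = (1 / 2 * K) * (- cnj (b s)) \<and> d = (1 / 2 * K) * cnj (a s)"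
      by (simp only: vec_eq_iff forall_2 mate_def c_def d_def a_def b_def vector_smult_component vector_2)
    finally show ?thesis
      by simp
  qed
  have cplx: "((\<lambda>t. Complex (f t) (g t)) has_vector_derivative Complex x y) F \<longleftrightarrow>
     (f has_vector_derivative x) F \<and> (g has_vector_derivative y) F" for f g x y
    using has_vector_derivative_complex_iff
      [of "\<lambda>t. Complex (f t) (g t)" "Complex x y" F]
    by (simp add: o_def has_real_derivative_iff_has_vector_derivative)
  have real: "((\<lambda>t. complex_of_real (f t)) has_vector_derivative complex_of_real x) F \<longleftrightarrow>
     (f has_vector_derivative x) F" for f x
    using cplx[of f "\<lambda>_. 0" x 0] by (simp add: complex_of_real_def F_def)
  note comps = represents_triad_components[OF rep, folded a_def b_def]
  have Q: "((\<lambda>t. (a t)\<^sup>2 - (b t)\<^sup>2) has_vector_derivative 2 * (a s * c - b s * d)) F"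
      "((\<lambda>t. \<i> * ((a t)\<^sup>2 + (b t)\<^sup>2)) has_vector_derivative 2 * \<i> * (a s * c + b s * d)) F"
      "((\<lambda>t. - 2 * a t * b t) has_vector_derivative - 2 * (a s * d + c * b s)) F"
    unfolding F_def power2_eq_square
    by (rule has_vector_derivative_eq_rhs, (rule rules)+, simp add: algebra_simps)+
  have N: "(N1 has_vector_derivative - p *\<^sub>R T s) F \<and> (N2 has_vector_derivative - q *\<^sub>R T s) F \<longleftrightarrow>
    2 * (a s * c - b s * d) = - K * (cnj (b s) * a s + cnj (a s) * b s) \<and>
    2 * \<i> * (a s * c + b s * d) = - K * (\<i> * (cnj (b s) * a s - cnj (a s) * b s)) \<and>
    - 2 * (a s * d + c * b s) = - K * (cnj (a s) * a s - cnj (b s) * b s)" (is "_ \<longleftrightarrow> ?eqs")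
  proof -
    have "(N1 has_vector_derivative - p *\<^sub>R T s) F \<and> (N2 has_vector_derivative - q *\<^sub>R T s) F \<longleftrightarrow>
      (\<forall>j. ((\<lambda>t. Complex (N1 t $ j) (N2 t $ j)) has_vector_derivative - K * T s $ j) F)"
    proof -
      \<comment> \<open>As \<open>T\<close> is real, the real and imaginary parts of
        \<open>-K T\<close> are the right sides of the equations for \<open>N1\<close> and
        \<open>N2\<close>.\<close>
      have "- K * T s $ j = Complex (- p * T s $ j) (- q * T s $ j)" for j
        by (simp add: K_def complex_eq_iff)
      then show ?thesis
        by (simp add: cplx[unfolded F_def] has_vector_derivative_vec_iff F_def all_conj_distrib)
    qed
    also have "\<dots> \<longleftrightarrow> - K * T s $ 1 = 2 * (a s * c - b s * d) \<and>
       - K * T s $ 2 = 2 * \<i> * (a s * c + b s * d) \<and> - K * T s $ 3 = - 2 * (a s * d + c * b s)"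
      by (simp only: forall_3 deriv_iff[OF comps(1) Q(1)] deriv_iff[OF comps(2) Q(2)]
          deriv_iff[OF comps(3) Q(3)])
    also have "\<dots> \<longleftrightarrow> ?eqs"
      by (simp only: comps[OF s]) (auto simp only:)
    finally show ?thesis .
  qed
  have T: "(T has_vector_derivative p *\<^sub>R N1 s + q *\<^sub>R N2 s) F"
    if cd: "c = - K / 2 * cnj (b s)" "d = K / 2 * cnj (a s)"
  proof -
    \<comment> \<open>This is the real part of \<open>cnj K * (N1 + i N2)\<close>, written as half
      the sum with its conjugate so that the formulas in \<open>a\<close> and \<open>b\<close> can
      be substituted.\<close>
    have KQ: "complex_of_real ((p *\<^sub>R N1 s + q *\<^sub>R N2 s) $ j) =
      (cnj K * Complex (N1 s $ j) (N2 s $ j) + K * cnj (Complex (N1 s $ j) (N2 s $ j))) / 2" for j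
      by (simp add: K_def complex_eq_iff)
    have "\<forall>j. ((\<lambda>t. complex_of_real (T t $ j)) has_vector_derivative
        complex_of_real ((p *\<^sub>R N1 s + q *\<^sub>R N2 s) $ j)) F"
      unfolding forall_3 KQ comps(1-3)[OF s] F_def
      by (intro conjI; rule has_vector_derivative_transform[OF s], erule comps;
          rule has_vector_derivative_eq_rhs, (rule rules)+,
          simp add: cd power2_eq_square field_simps)
    then show ?thesis
      unfolding real by (simp only: F_def has_vector_derivative_vec_iff[of T] simp_thms)
  qed
  \<comment> \<open>For the zero spinor the normalization sum would be 0 instead of 1.\<close>
  have "a s \<noteq> 0 \<or> b s \<noteq> 0"
    using unit by (auto simp: normalized_spinor_def sum_2 a_def b_def)
  note velocity = spinor_velocity_iff[OF this, of c d K]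
  show ?thesis
    unfolding spin_iff unfolding F_def[symmetric] N
    using velocity T by blast
qed

theorem theorem1:
  fixes I :: "real set"
    and \<alpha> T N1 N2 :: "real \<Rightarrow> real ^ 3"
    and k1 k2 :: "real \<Rightarrow> real"
    and \<phi> :: "real \<Rightarrow> spinor"
  assumes "is_interval I" and "interior I \<noteq> {}"
    and "unit_speed_curve_with_tangent I \<alpha> T"
    and "T differentiable_on I" and "N1 differentiable_on I" and "N2 differentiable_on I"
    and "\<And>s. s \<in> I \<Longrightarrow> positive_orthonormal (T s) (N1 s) (N2 s)"
    and "\<phi> differentiable_on I"
    and "\<And>s. s \<in> I \<Longrightarrow> normalized_spinor (\<phi> s)"
    and "\<And>s. s \<in> I \<Longrightarrow> represents_triad (\<phi> s) (N1 s) (N2 s) (T s)"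
  shows "type1_Bishop_equations I T N1 N2 k1 k2 \<longleftrightarrow> spinor_equation I \<phi> k1 k2"
  unfolding type1_Bishop_equations_def spinor_equation_def
proof (rule ball_cong[OF refl])
  fix s
  assume s: "s \<in> I"
  have "at s within I \<noteq> bot" "\<phi> differentiable (at s within I)"
    using interval_at_within_nontrivial assms(1,2,8) s unfolding differentiable_on_def by blast+
  then show "(T has_vector_derivative k1 s *\<^sub>R N1 s + k2 s *\<^sub>R N2 s) (at s within I) \<and>
        (N1 has_vector_derivative - k1 s *\<^sub>R T s) (at s within I) \<and>
        (N2 has_vector_derivative - k2 s *\<^sub>R T s) (at s within I) \<longleftrightarrow>
     (\<phi> has_vector_derivative
        ((1 / 2) * (complex_of_real (k1 s) + \<i> * complex_of_real (k2 s))) *s mate (\<phi> s))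
        (at s within I)"
    using s assms(9,10) by (intro Bishop_iff_spinor_at)
qed

end
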